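(* Let $n\in\mathbb{N}$, and let $T\in\mathbb{B}(\mathcal{H})$ be an $n$-power quasinormal operator. If $T$ is paranormal, then $T$ is quasinormal.
   Context: $\mathbb{N}$ denotes the positive integers. $\mathbb{B}(\mathcal{H})$ is the algebra of bounded linear operators on a complex Hilbert space $\mathcal{H}$. Write $[S,T]=ST-TS$. $T$ is quasinormal if $[T,T^*T]=0$, $n$-power quasinormal if $[T^n,T^*T]=0$, and paranormal if $\|Tx\|^2\le\|T^2x\|\,\|x\|$ for all $x\in\mathcal{H}$. *)

theory Defs
  imports "HOL-Analysis.Analysis"
begin

text \<open>
  Complex inner product spaces as a type class on top of \<^class>\<open>real_inner\<close>: the real
  structure (real scaling, real inner product, norm, topology) is not additional data but
  is determined by the complex one through the axioms \<open>scaleR_scaleC\<close> and \<open>inner_eq_Re_cinner\<close>,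
  so that the norm is \<open>norm x = sqrt (Re (cinner x x))\<close>. Positivity and definiteness
  of \<open>cinner\<close> come from \<^class>\<open>real_inner\<close>. The inner product is linear in its first argument.
\<close>

class complex_inner = real_inner +
  fixes scaleC :: "complex \<Rightarrow> 'a \<Rightarrow> 'a"  (infixr "*\<^sub>C" 75)
    and cinner :: "'a \<Rightarrow> 'a \<Rightarrow> complex"
  assumes scaleC_add_right: "a *\<^sub>C (x + y) = a *\<^sub>C x + a *\<^sub>C y"
    and scaleC_add_left: "(a + b) *\<^sub>C x = a *\<^sub>C x + b *\<^sub>C x"
    and scaleC_scaleC: "a *\<^sub>C (b *\<^sub>C x) = (a * b) *\<^sub>C x"
    and scaleR_scaleC: "scaleR r x = complex_of_real r *\<^sub>C x"
    and cinner_commute: "cinner x y = cnj (cinner y x)"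
    and cinner_add_left: "cinner (x + y) z = cinner x z + cinner y z"
    and cinner_scaleC_left: "cinner (a *\<^sub>C x) y = a * cinner x y"
    and inner_eq_Re_cinner: "inner x y = Re (cinner x y)"

class chilbert_space = complex_inner + complete_space

locale bounded_clinear = bounded_linear f
  for f :: "'a::complex_inner \<Rightarrow> 'b::complex_inner" +
  assumes scaleC: "f (c *\<^sub>C x) = c *\<^sub>C f x"

text \<open>
  For a bounded operator on a Hilbert space the operator chosen here exists (Riesz) and is
  unique (nondegeneracy of \<open>cinner\<close>).
\<close>

definition cadjoint :: "('a::chilbert_space \<Rightarrow> 'a) \<Rightarrow> ('a \<Rightarrow> 'a)" where
  "cadjoint T = (SOME S. \<forall>x y. cinner (T x) y = cinner x (S y))"

definition commutator :: "('a::complex_inner \<Rightarrow> 'a) \<Rightarrow> ('a \<Rightarrow> 'a) \<Rightarrow> ('a \<Rightarrow> 'a)" where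
  "commutator S T = (\<lambda>x. S (T x) - T (S x))"

definition quasinormal :: "('a::chilbert_space \<Rightarrow> 'a) \<Rightarrow> bool" where
  "quasinormal T \<longleftrightarrow> commutator T (cadjoint T \<circ> T) = (\<lambda>x. 0)"

definition power_quasinormal :: "nat \<Rightarrow> ('a::chilbert_space \<Rightarrow> 'a) \<Rightarrow> bool" where
  "power_quasinormal n T \<longleftrightarrow> commutator (T ^^ n) (cadjoint T \<circ> T) = (\<lambda>x. 0)"

definition paranormal :: "('a::complex_inner \<Rightarrow> 'a) \<Rightarrow> bool" where
  "paranormal T \<longleftrightarrow> (\<forall>x. (norm (T x))\<^sup>2 \<le> norm ((T ^^ 2) x) * norm x)"

end

theory Submission
  imports Defs "HOL-Computational_Algebra.Polynomial"
begin

text \<open>Put \<open>A = T\<^sup>* T\<close>; after scaling, \<open>T\<close> is a contraction and \<open>0 \<le> A \<le> 1\<close>. Only the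
  real inner product matters from then on. Write \<open>b k x = \<parallel>T\<^sup>k x\<parallel>\<^sup>2\<close>. Paranormality says that
  \<open>b (k + 2) x - 2 l b (k + 1) x + l\<^sup>2 b k x \<ge> 0\<close> for all \<open>l \<ge> 0\<close>, a convexity property which by
  summation yields the tangent inequalities
  \<open>b n x - n l\<^sup>n\<^sup>-\<^sup>1 b 1 x + (n - 1) l\<^sup>n b 0 x \<ge> 0\<close> and
  \<open>n b (n + 1) x - (n + 1) l b n x + l\<^sup>n\<^sup>+\<^sup>1 b 0 x \<ge> 0\<close>.

  Since \<open>A\<close> commutes with \<open>T\<^sup>n\<close>, it is symmetric for the form \<open>\<langle>T\<^sup>n x, T\<^sup>n y\<rangle>\<close>, and
  \<open>b (n + 1) x = \<langle>T\<^sup>n A x, T\<^sup>n x\<rangle>\<close>. So all coefficients in the tangent inequalities are forms for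
  which \<open>A\<close> is symmetric, and the scalar \<open>l\<close> may be replaced by \<open>A\<close> (\<open>operator_substitution\<close>).
  This gives \<open>b n x \<ge> \<langle>A\<^sup>n x, x\<rangle>\<close> and \<open>b (n + 1) x \<le> \<langle>A\<^sup>n\<^sup>+\<^sup>1 x, x\<rangle>\<close>. With the first at \<open>T x\<close>
  and the second at \<open>x\<close>, the polynomial \<open>t\<^sup>n - n l\<^sup>n\<^sup>-\<^sup>1 t + (n - 1) l\<^sup>n\<close>, which is \<open>(t - l)\<^sup>2\<close>
  times a polynomial with nonnegative coefficients, leads to
  \<open>(n - 1) l\<^sup>n\<^sup>-\<^sup>2 \<parallel>(A - l) T x\<parallel>\<^sup>2 \<le> n\<^sup>2 \<parallel>(A - l) x\<parallel>\<^sup>2\<close> for \<open>0 \<le> l \<le> 1\<close> and \<open>n \<ge> 2\<close>.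

  Hence \<open>C = T A - A T = T (A - l) - (A - l) T\<close> satisfies \<open>\<parallel>C x\<parallel> \<le> K \<parallel>(A - l) x\<parallel>\<close> with \<open>K\<close>
  uniform for \<open>l\<close> away from \<open>0\<close>. Cut \<open>x\<close> into \<open>M\<close> orthogonal pieces living in spectral
  slices of \<open>A\<close> of width \<open>1 / M\<close>: the norms of their images under \<open>C\<close> add up to at most
  \<open>K \<surd>M \<parallel>x\<parallel> / M\<close>, which tends to \<open>0\<close>, so \<open>C = 0\<close> (\<open>vanishing_by_slicing\<close>).
  The part of \<open>x\<close> near the kernel of \<open>A\<close>, where \<open>K\<close> is not controlled, is negligible because
  \<open>\<parallel>C x\<parallel>\<^sup>2 \<le> 4 \<parallel>A x\<parallel> \<parallel>x\<parallel>\<close>.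

  Instead of the spectral theorem, both the substitution of \<open>A\<close> for \<open>l\<close> and the slicing use the
  Bernstein polynomials of \<open>A\<close>. Their positivity with respect to any positive form for which \<open>A\<close>
  is symmetric comes from an inequality of Reid.\<close>

section \<open>Polynomials in a linear operator\<close>

text \<open>The value at \<open>x\<close> of the operator obtained by substituting \<open>A\<close> into the polynomial \<open>p\<close>.\<close>

definition poly_op :: "('a::real_vector \<Rightarrow> 'a) \<Rightarrow> real poly \<Rightarrow> 'a \<Rightarrow> 'a" where
  "poly_op A p x = (\<Sum>k\<le>degree p. coeff p k *\<^sub>R (A ^^ k) x)"

lemma poly_op_0 [simp]: "poly_op A 0 x = 0"
  by (simp add: poly_op_def)

lemma linear_funpow:
  fixes A :: "'a::real_vector \<Rightarrow> 'a"
  assumes "linear A"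
  shows "linear (A ^^ k)"
proof (induction k)
  case 0
  have "A ^^ 0 = id" by simp
  then show ?case by (simp only: linear_id)
next
  case (Suc k)
  then show ?case using linear_compose[OF Suc assms] by (simp add: o_def)
qed

lemma poly_op_pCons:
  assumes "linear A"
  shows "poly_op A (pCons a p) x = a *\<^sub>R x + A (poly_op A p x)"
proof (cases "p = 0")
  case True
  then show ?thesis by (cases "a = 0") (simp_all add: poly_op_def linear_0[OF assms])
next
  case False
  then show ?thesis
    by (simp add: poly_op_def sum.atMost_Suc_shift linear_sum[OF assms] linear_scale[OF assms]
        del: sum.atMost_Suc)
qed

lemma poly_op_linear:
  assumes "linear A"
  shows "linear (poly_op A p)"
  unfolding poly_op_def
  by (intro linear_compose_sum ballI linear_compose_scale_right linear_funpow assms)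

lemma poly_op_add:
  assumes "linear A"
  shows "poly_op A (p + q) x = poly_op A p x + poly_op A q x"
  by (induction p q rule: poly_induct2)
     (simp_all add: poly_op_pCons[OF assms] linear_add[OF assms] scaleR_add_left)

lemma poly_op_smult:
  assumes "linear A"
  shows "poly_op A (smult c p) x = c *\<^sub>R poly_op A p x"
  by (induction p)
     (simp_all add: poly_op_pCons[OF assms] linear_scale[OF assms] scaleR_add_right)

lemma poly_op_mult:
  assumes "linear A"
  shows "poly_op A (p * q) x = poly_op A p (poly_op A q x)"
  by (induction p)
     (simp_all add: poly_op_pCons[OF assms] poly_op_add[OF assms] poly_op_smult[OF assms]
        linear_add[OF assms])

lemma poly_op_apply:
  assumes "linear A"
  shows "poly_op A p (A x) = A (poly_op A p x)"
  by (induction p)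
     (simp_all add: poly_op_pCons[OF assms] linear_add[OF assms] linear_scale[OF assms]
        linear_0[OF assms])

lemma poly_op_sum:
  assumes "linear A"
  shows "poly_op A (\<Sum>i\<in>I. p i) x = (\<Sum>i\<in>I. poly_op A (p i) x)"
  by (induction I rule: infinite_finite_induct) (simp_all add: poly_op_add[OF assms])

lemma poly_op_bounded:
  fixes A :: "'a::real_normed_vector \<Rightarrow> 'a"
  assumes "bounded_linear A"
  shows "bounded_linear (poly_op A p)"
proof (induction p)
  case 0
  have "poly_op A 0 = (\<lambda>x. 0)" by (simp add: fun_eq_iff)
  then show ?case by simp
next
  case (pCons a p)
  have "poly_op A (pCons a p) = (\<lambda>x. a *\<^sub>R x + A (poly_op A p x))"
    by (simp add: fun_eq_iff poly_op_pCons bounded_linear.linear[OF assms])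
  moreover have "bounded_linear (\<lambda>x. a *\<^sub>R x + A (poly_op A p x))"
    by (intro bounded_linear_add bounded_linear_scaleR_right
        bounded_linear_compose[OF assms pCons(2)])
  ultimately show ?case by simp
qed

text \<open>The Bernstein polynomials, which form a partition of unity on the interval \<open>[0,1]\<close>.\<close>

definition bern :: "nat \<Rightarrow> nat \<Rightarrow> real poly" where
  "bern N i = smult (of_nat (N choose i)) ([:0, 1:] ^ i * [:1, -1:] ^ (N - i))"

lemma poly_bern: "poly (bern N i) t = Bernstein N i t"
  by (simp add: bern_def Bernstein_def)

lemma sum_bern: "(\<Sum>i\<le>N. bern N i) = 1"
  by (simp add: poly_eq_poly_eq_iff[symmetric] fun_eq_iff poly_sum poly_bern)

lemma bern_variance:
  assumes "N > 0"
  shows "(\<Sum>i\<le>N. bern N i * [:- (real i / real N), 1:] ^ 2) = smult (1 / real N) [:0, 1, -1:]"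
proof -
  have "(\<Sum>i\<le>N. Bernstein N i t * (t - real i / real N)\<^sup>2) = t * (1 - t) / real N" for t
  proof -
    have "(\<Sum>i\<le>N. Bernstein N i t * (t - real i / real N)\<^sup>2)
        = (\<Sum>i\<le>N. t\<^sup>2 * Bernstein N i t + (1 - 2 * real N * t) / (real N)\<^sup>2 * (real i * Bernstein N i t)
             + (1 / (real N)\<^sup>2) * (real i * (real i - 1) * Bernstein N i t))"
      using assms by (intro sum.cong refl) (simp add: field_simps power2_eq_square)
    also have "\<dots> = t\<^sup>2 + (1 - 2 * real N * t) / (real N)\<^sup>2 * (real N * t)
             + (1 / (real N)\<^sup>2) * (real N * (real N - 1) * t\<^sup>2)"
      by (simp add: sum.distrib sum_distrib_left[symmetric] del: times_divide_eq_left)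
    also have "\<dots> = t * (1 - t) / real N"
      using assms by (simp add: field_simps power2_eq_square)
    finally show ?thesis .
  qed
  then show ?thesis
    by (simp add: poly_eq_poly_eq_iff[symmetric] fun_eq_iff poly_sum poly_bern algebra_simps
        diff_divide_distrib add_divide_distrib)
qed

section \<open>Symmetric forms\<close>

text \<open>Bounded symmetric bilinear forms, not necessarily positive.\<close>

definition sym_form :: "('a::real_normed_vector \<Rightarrow> 'a \<Rightarrow> real) \<Rightarrow> bool" where
  "sym_form F \<longleftrightarrow> bounded_bilinear F \<and> (\<forall>x y. F x y = F y x)"

lemma sym_form_square:
  assumes "sym_form F"
  shows "F (x + t *\<^sub>R y) (x + t *\<^sub>R y) = F x x + 2 * t * F x y + t\<^sup>2 * F y y"
proof -
  interpret bounded_bilinear F using assms by (simp add: sym_form_def)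
  have "F y x = F x y" using assms by (simp add: sym_form_def)
  then show ?thesis
    by (simp add: add_left add_right scaleR_left scaleR_right power2_eq_square algebra_simps)
qed

lemma form_Cauchy_Schwarz:
  assumes F: "sym_form F" and pos: "\<And>x. 0 \<le> F x x"
  shows "(F x y)\<^sup>2 \<le> F x x * F y y"
proof (cases "F y y = 0")
  case True
  have "F x y = 0"
  proof (rule ccontr)
    assume nz: "F x y \<noteq> 0"
    have "0 \<le> F x x + 2 * (- (F x x + 1) / (2 * F x y)) * F x y"
      using pos[of "x + (- (F x x + 1) / (2 * F x y)) *\<^sub>R y"] True
      by (simp only: sym_form_square[OF F])
    also have "\<dots> = -1" using nz by (simp add: field_simps)
    finally show False by simp
  qed
  then show ?thesis using True by simp
next
  case False
  then have p: "F y y > 0" using pos[of y] by simp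
  have "0 \<le> F x x + 2 * (- F x y / F y y) * F x y + (- F x y / F y y)\<^sup>2 * F y y"
    using pos[of "x + (- F x y / F y y) *\<^sub>R y"] by (simp only: sym_form_square[OF F])
  also have "\<dots> = F x x - (F x y)\<^sup>2 / F y y" using p by (simp add: field_simps power2_eq_square)
  finally show ?thesis using p by (simp add: field_simps)
qed

text \<open>If \<open>S\<close> is a contraction, then the numbers \<open>a j = F (S\<^sup>j x) (S\<^sup>j x)\<close> are bounded
  and satisfy \<open>(a j)\<^sup>2 \<le> a 0 * a (2 * j)\<close>, which is impossible if \<open>a 1 > a 0\<close>.\<close>

lemma Reid_inequality:
  assumes F: "sym_form F" and pos: "\<And>x. 0 \<le> F x x"
    and S: "\<And>x y. F (S x) y = F x (S y)" and contr: "\<And>x. norm (S x) \<le> norm x"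
  shows "\<bar>F (S x) x\<bar> \<le> F x x"
proof -
  interpret bounded_bilinear F using F by (simp add: sym_form_def)
  define a where "a j = F ((S ^^ j) x) ((S ^^ j) x)" for j
  have shift: "F ((S ^^ j) u) v = F u ((S ^^ j) v)" for j u v
    by (induction j arbitrary: u v) (simp_all add: S funpow_swap1)
  have dbl: "(a j)\<^sup>2 \<le> a 0 * a (2 * j)" for j
  proof -
    have "a j = F x ((S ^^ (2 * j)) x)"
      unfolding a_def shift by (simp add: mult_2 funpow_add)
    then show ?thesis using form_Cauchy_Schwarz[OF F pos] by (simp add: a_def)
  qed
  obtain K where K: "K \<ge> 0" "\<And>u v. norm (F u v) \<le> norm u * norm v * K"
    using nonneg_bounded by blast
  have Sj: "norm ((S ^^ j) x) \<le> norm x" for j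
    by (induction j) (auto intro: order_trans[OF contr])
  have bnd: "a j \<le> norm x * norm x * K" for j
  proof -
    have "a j \<le> norm ((S ^^ j) x) * norm ((S ^^ j) x) * K"
      using K(2)[of "(S ^^ j) x" "(S ^^ j) x"] by (simp add: a_def)
    also have "\<dots> \<le> norm x * norm x * K"
      by (intro mult_right_mono mult_mono Sj K) auto
    finally show ?thesis .
  qed
  have a10: "a 1 \<le> a 0"
  proof (rule ccontr)
    assume "\<not> a 1 \<le> a 0"
    then have gt: "a 0 < a 1" by simp
    have a0: "a 0 \<ge> 0" by (simp add: a_def pos)
    have p0: "a 0 > 0"
    proof (rule ccontr)
      assume "\<not> a 0 > 0"
      then have "a 0 = 0" using a0 by simp
      then have "(a 1)\<^sup>2 \<le> 0" using dbl[of 1] by simp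
      then have "a 1 = 0" by simp
      then show False using gt a0 by simp
    qed
    define r where "r = a 1 / a 0"
    have r1: "r > 1" using gt p0 by (simp add: r_def)
    \<comment> \<open>repeated doubling of the exponent\<close>
    have grow: "a 0 * r ^ (2 ^ k) \<le> a (2 ^ k)" for k
    proof (induction k)
      case 0
      then show ?case using p0 by (simp add: r_def)
    next
      case (Suc k)
      have "a 0 * (a 0 * r ^ (2 ^ Suc k)) = (a 0 * r ^ (2 ^ k))\<^sup>2"
        by (simp add: power2_eq_square mult_2 power_add)
      also have "\<dots> \<le> (a (2 ^ k))\<^sup>2" using Suc p0 r1 by (intro power_mono) auto
      also have "\<dots> \<le> a 0 * a (2 ^ Suc k)" using dbl[of "2 ^ k"] by simp
      finally show ?case using p0 by simp
    qed
    obtain k where k: "norm x * norm x * K / a 0 < r ^ k" using real_arch_pow[OF r1] by blast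
    have "r ^ k \<le> r ^ (2 ^ k)" using r1 by (intro power_increasing) (auto intro: less_imp_le)
    then have "norm x * norm x * K / a 0 < r ^ (2 ^ k)" using k by simp
    then have "norm x * norm x * K < a 0 * r ^ (2 ^ k)" using p0 by (simp add: field_simps)
    then show False using grow[of k] bnd[of "2 ^ k"] by simp
  qed
  have "(F (S x) x)\<^sup>2 \<le> a 1 * a 0"
    using form_Cauchy_Schwarz[OF F pos, of "S x" x] by (simp add: a_def)
  also have "\<dots> \<le> (a 0)\<^sup>2" using a10 pos by (simp add: power2_eq_square a_def mult_right_mono)
  finally show ?thesis using pos[of x] by (simp add: a_def abs_le_square_iff[symmetric])
qed

section \<open>Second differences of real sequences\<close>

text \<open>The second difference of \<open>a\<close> at \<open>k\<close> with weight \<open>l\<close>; for positive \<open>l\<close> it is \<open>l\<^sup>k\<^sup>+\<^sup>2\<close> times the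
  ordinary second difference of \<open>a k / l\<^sup>k\<close>.\<close>

definition second_diff :: "real \<Rightarrow> (nat \<Rightarrow> real) \<Rightarrow> nat \<Rightarrow> real" where
  "second_diff l a k = a (k + 2) - 2 * l * a (k + 1) + l\<^sup>2 * a k"

text \<open>For \<open>a k = t\<^sup>k\<close> the left-hand side is the deviation of \<open>t\<^sup>m\<^sup>+\<^sup>1\<close> from its tangent at \<open>t = l\<close>,
  and the right-hand side exhibits the factor \<open>(t - l)\<^sup>2\<close>.\<close>

lemma tangent_remainder:
  "a (Suc m) - real (Suc m) * l ^ m * a 1 + real m * l ^ Suc m * a 0
    = (\<Sum>j<m. real (Suc j) * l ^ j * second_diff l a (m - 1 - j))"
proof (induction m arbitrary: a)
  case 0
  then show ?case by simp
next
  case (Suc m)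
  have "(\<Sum>j<m. real (Suc j) * l ^ j * second_diff l a (m - j))
      = (\<Sum>j<m. real (Suc j) * l ^ j * second_diff l (\<lambda>k. a (Suc k)) (m - 1 - j))"
    by (intro sum.cong refl) (auto simp: second_diff_def Suc_diff_Suc)
  also have "\<dots> = a (Suc (Suc m)) - real (Suc m) * l ^ m * a 2 + real m * l ^ Suc m * a 1"
    using Suc[of "\<lambda>k. a (Suc k)"] by (simp add: numeral_2_eq_2)
  finally show ?case
    by (simp add: second_diff_def algebra_simps power2_eq_square numeral_2_eq_2)
qed

lemma tangent_nonneg:
  assumes "l \<ge> 0" and "\<And>k. 0 \<le> second_diff l a k"
  shows "0 \<le> a (Suc m) - real (Suc m) * l ^ m * a 1 + real m * l ^ Suc m * a 0"
  unfolding tangent_remainder using assms by (intro sum_nonneg) auto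

text \<open>The same convexity used in the other direction: for positive \<open>l\<close>, the rescaled sequence \<open>a k / l\<^sup>k\<close> lies at
  \<open>k = 0\<close> above the line through its values at \<open>n\<close> and \<open>n + 1\<close>.\<close>

lemma backward_tangent_nonneg:
  assumes l: "l \<ge> 0" and sd: "\<And>k. 0 \<le> second_diff l a k"
  shows "0 \<le> real n * a (Suc n) - real (Suc n) * l * a n + l ^ Suc n * a 0"
proof (induction n)
  case 0
  then show ?case by simp
next
  case (Suc n)
  have "0 \<le> l * (real n * a (Suc n) - real (Suc n) * l * a n + l ^ Suc n * a 0)
      + real (Suc n) * second_diff l a n"
    by (intro add_nonneg_nonneg mult_nonneg_nonneg[OF l Suc] mult_nonneg_nonneg[OF _ sd]) simp
  also have "\<dots> = real (Suc n) * a (Suc (Suc n)) - real (Suc (Suc n)) * l * a (Suc n)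
      + l ^ Suc (Suc n) * a 0"
    by (simp add: second_diff_def algebra_simps power2_eq_square)
  finally show ?case .
qed

section \<open>Positive contractions\<close>

text \<open>A symmetric operator \<open>A\<close> with \<open>0 \<le> A \<le> 1\<close>. The two order relations are encoded as norm bounds
  on \<open>A\<close> and \<open>1 - A\<close>, the form in which Reid's inequality uses them.\<close>

locale positive_contraction =
  fixes A :: "'a::real_inner \<Rightarrow> 'a"
  assumes lin: "linear A" and sym: "inner (A x) y = inner x (A y)"
    and contr: "norm (A x) \<le> norm x" and contr': "norm (x - A x) \<le> norm x"
begin

lemma bounded: "bounded_linear A"
  by (rule bounded_linear_intro[where K = 1])
     (auto simp: linear_add[OF lin] linear_scale[OF lin] contr)

text \<open>The forms for which \<open>A\<close> is symmetric. They are closed under linear combinations and under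
  composition with \<open>A\<close>.\<close>

definition A_form :: "('a \<Rightarrow> 'a \<Rightarrow> real) \<Rightarrow> bool" where
  "A_form F \<longleftrightarrow> sym_form F \<and> (\<forall>x y. F (A x) y = F x (A y))"

lemma A_form_sym: "A_form F \<Longrightarrow> sym_form F"
  by (simp add: A_form_def)

lemma A_form_bilinear: "A_form F \<Longrightarrow> bounded_bilinear F"
  by (simp add: A_form_def sym_form_def)

lemma A_form_commute: "A_form F \<Longrightarrow> F x y = F y x"
  by (simp add: A_form_def sym_form_def)

lemma A_form_shift: "A_form F \<Longrightarrow> F (A x) y = F x (A y)"
  by (simp add: A_form_def)

lemma A_form_inner: "A_form inner"
  by (simp add: A_form_def sym_form_def bounded_bilinear_inner sym) (metis inner_commute)

lemma A_form_combine:
  assumes "A_form F" "A_form G"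
  shows "A_form (\<lambda>x y. F x y + c * G x y)"
proof -
  interpret F: bounded_bilinear F by (rule A_form_bilinear[OF assms(1)])
  interpret G: bounded_bilinear G by (rule A_form_bilinear[OF assms(2)])
  obtain K where K: "\<And>u v. norm (F u v) \<le> norm u * norm v * K" using F.bounded by blast
  obtain L where L: "\<And>u v. norm (G u v) \<le> norm u * norm v * L" using G.bounded by blast
  have "norm (F u v + c * G u v) \<le> norm u * norm v * (K + \<bar>c\<bar> * L)" for u v
  proof -
    have "norm (F u v + c * G u v) \<le> norm (F u v) + \<bar>c\<bar> * norm (G u v)"
      by (simp add: abs_mult[symmetric])
    also have "\<dots> \<le> norm u * norm v * K + \<bar>c\<bar> * (norm u * norm v * L)"
      by (intro add_mono mult_left_mono K L) auto
    finally show ?thesis by (simp add: algebra_simps)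
  qed
  then have "\<exists>K. \<forall>u v. norm (F u v + c * G u v) \<le> norm u * norm v * K"
    by blast
  then have "bounded_bilinear (\<lambda>x y. F x y + c * G x y)"
    by (intro bounded_bilinear.intro)
       (simp_all add: F.add_left F.add_right G.add_left G.add_right F.scaleR_left F.scaleR_right
          G.scaleR_left G.scaleR_right algebra_simps)
  then show ?thesis
    using A_form_commute[OF assms(1)] A_form_commute[OF assms(2)]
      A_form_shift[OF assms(1)] A_form_shift[OF assms(2)]
    unfolding A_form_def sym_form_def by metis
qed

lemma A_form_scale:
  assumes "A_form F"
  shows "A_form (\<lambda>x y. c * F x y)"
proof -
  have "A_form (\<lambda>x y. F x y + (c - 1) * F x y)" by (intro A_form_combine assms)
  then show ?thesis by (simp add: algebra_simps)
qed

lemma A_form_apply: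
  assumes "A_form F"
  shows "A_form (\<lambda>x y. F (A x) y)"
proof -
  have "bounded_bilinear (\<lambda>x y. F (A x) y)"
    by (rule bounded_bilinear.comp1[OF A_form_bilinear[OF assms] bounded])
  moreover have "F (A x) y = F (A y) x" for x y
    using A_form_shift[OF assms, of x y] A_form_commute[OF assms, of x "A y"] by simp
  moreover have "F (A (A x)) y = F (A x) (A y)" for x y
    using A_form_shift[OF assms] by simp
  ultimately show ?thesis by (simp add: A_form_def sym_form_def)
qed

lemma A_form_poly_op:
  assumes "A_form F"
  shows "F (poly_op A p x) y = F x (poly_op A p y)"
proof -
  interpret F: bounded_bilinear F by (rule A_form_bilinear[OF assms])
  show ?thesis
    by (induction p arbitrary: x y)
       (simp_all add: poly_op_pCons[OF lin] F.zero_left F.zero_right F.add_left F.add_right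
         F.scaleR_left F.scaleR_right A_form_shift[OF assms] poly_op_apply[OF lin])
qed

lemma A_form_apply_pos:
  assumes F: "A_form F" and pos: "\<And>x. 0 \<le> F x x"
  shows "0 \<le> F (A x) x" and "0 \<le> F (x - A x) x"
proof -
  interpret F: bounded_bilinear F by (rule A_form_bilinear[OF F])
  have "\<bar>F (A x) x\<bar> \<le> F x x"
    by (rule Reid_inequality[where S = A, OF A_form_sym[OF F] pos A_form_shift[OF F] contr])
  then show "0 \<le> F (x - A x) x" by (simp add: F.diff_left)
  have "\<bar>F (x - A x) x\<bar> \<le> F x x"
    by (rule Reid_inequality[where S = "\<lambda>x. x - A x", OF A_form_sym[OF F] pos _ contr'])
       (simp add: F.diff_left F.diff_right A_form_shift[OF F])
  then show "0 \<le> F (A x) x" by (simp add: F.diff_left)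
qed

lemma poly_op_id: "poly_op A 1 x = x" "poly_op A [:0, 1:] x = A x"
    "poly_op A [:c, 1:] x = c *\<^sub>R x + A x" "poly_op A [:1, -1:] x = x - A x"
    "poly_op A [:0, 1, -1:] x = A (x - A x)"
  by (simp_all add: poly_op_pCons[OF lin] linear_0[OF lin] one_pCons linear_neg[OF lin])

text \<open>Positivity of \<open>F (A\<^sup>a (1 - A)\<^sup>b x) x\<close> by induction: \<open>F (A x) y\<close> and \<open>F ((1 - A) x) y\<close>
  are again positive forms for which \<open>A\<close> is symmetric.\<close>

lemma monomial_pos:
  assumes "A_form F" and "\<And>x. 0 \<le> F x x"
  shows "0 \<le> F (poly_op A ([:0, 1:] ^ a * [:1, -1:] ^ b) x) x"
  using assms
proof (induction a arbitrary: F)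
  case 0
  then show ?case
  proof (induction b arbitrary: F)
    case 0
    then show ?case by (simp add: poly_op_id)
  next
    case (Suc b)
    interpret F: bounded_bilinear F by (rule A_form_bilinear[OF Suc.prems(1)])
    have "A_form (\<lambda>x y. F x y + (-1) * F (A x) y)"
      by (intro A_form_combine A_form_apply Suc.prems)
    then have *: "A_form (\<lambda>x y. F (x - A x) y)" by (simp add: F.diff_left)
    have "0 \<le> F (poly_op A [:1, -1:] (poly_op A ([:1, -1:] ^ b) x)) x"
      using Suc.IH[OF *] A_form_apply_pos(2)[OF Suc.prems] by (simp add: poly_op_id)
    then show ?case by (simp add: poly_op_mult[OF lin, symmetric])
  qed
next
  case (Suc a)
  have "0 \<le> F (poly_op A [:0, 1:] (poly_op A ([:0, 1:] ^ a * [:1, -1:] ^ b) x)) x"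
    using Suc.IH[OF A_form_apply[OF Suc.prems(1)]] A_form_apply_pos(1)[OF Suc.prems]
    by (simp add: poly_op_id)
  then show ?case by (simp only: poly_op_mult[OF lin, symmetric] power_Suc mult.assoc)
qed

lemma bern_pos:
  assumes F: "A_form F" and "\<And>x. 0 \<le> F x x"
  shows "0 \<le> F (poly_op A (bern N i) x) x"
proof -
  interpret F: bounded_bilinear F by (rule A_form_bilinear[OF F])
  show ?thesis
    unfolding bern_def poly_op_smult[OF lin] F.scaleR_left
    using monomial_pos[OF assms] by simp
qed

section \<open>Bernstein operators\<close>

text \<open>The operators \<open>bern_op N i\<close>, \<open>i \<le> N\<close>, form a partition of unity into positive operators, the
  \<open>i\<close>-th one being concentrated where the spectrum of \<open>A\<close> is near the node \<open>i / N\<close>.\<close>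

abbreviation bern_op :: "nat \<Rightarrow> nat \<Rightarrow> 'a \<Rightarrow> 'a" where
  "bern_op N i \<equiv> poly_op A (bern N i)"

text \<open>The deviation \<open>(A - i / N) x\<close> from the eigenvalue equation at the \<open>i\<close>-th node.\<close>

abbreviation node_dev :: "nat \<Rightarrow> nat \<Rightarrow> 'a \<Rightarrow> 'a" where
  "node_dev N i x \<equiv> A x - (real i / real N) *\<^sub>R x"

lemma poly_op_form: "sym_form (\<lambda>x y. inner (poly_op A p x) y)"
proof -
  have "bounded_bilinear (\<lambda>x y. inner (poly_op A p x) y)"
    by (rule bounded_bilinear.comp1[OF bounded_bilinear_inner poly_op_bounded[OF bounded]])
  moreover have "inner (poly_op A p x) y = inner (poly_op A p y) x" for x y
    using A_form_poly_op[OF A_form_inner] by (simp add: inner_commute)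
  ultimately show ?thesis by (auto simp: sym_form_def)
qed

lemma bern_op_pos: "0 \<le> inner (bern_op N i x) x"
  by (rule bern_pos[OF A_form_inner]) simp

lemma bern_op_diff: "bern_op N i (x - y) = bern_op N i x - bern_op N i y"
  by (rule linear_diff[OF poly_op_linear[OF lin]])

lemma bern_op_scale: "bern_op N i (c *\<^sub>R x) = c *\<^sub>R bern_op N i x"
  by (rule linear_scale[OF poly_op_linear[OF lin]])

lemma sum_bern_op: "(\<Sum>i\<le>N. bern_op N i x) = x"
  by (simp only: poly_op_sum[OF lin, symmetric] sum_bern poly_op_id)

lemma sum_bern_op_inner: "(\<Sum>i\<le>N. inner (bern_op N i x) y) = inner x y"
  by (simp only: inner_sum_left[symmetric] sum_bern_op)

text \<open>The concentration of \<open>bern_op N i\<close> near the node \<open>i / N\<close>, in mean square. This is the variance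
  \<open>t (1 - t) / N\<close> of a relative frequency, evaluated at \<open>A\<close>.\<close>

lemma bern_op_variance:
  assumes "N > 0"
  shows "(\<Sum>i\<le>N. inner (bern_op N i (node_dev N i x)) (node_dev N i x)) \<le> (norm x)\<^sup>2 / real N"
proof -
  have "inner (bern_op N i (node_dev N i x)) (node_dev N i x)
      = inner (poly_op A (bern N i * [:- (real i / real N), 1:] ^ 2) x) x" for i
  proof -
    define P where "P = [:- (real i / real N), 1:]"
    have "node_dev N i x = poly_op A P x" by (simp add: P_def poly_op_id)
    then have "inner (bern_op N i (node_dev N i x)) (node_dev N i x)
        = inner (poly_op A P (bern_op N i (poly_op A P x))) x"
      using A_form_poly_op[OF A_form_inner] by simp
    also have "poly_op A P (bern_op N i (poly_op A P x)) = poly_op A (bern N i * P ^ 2) x"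
      by (simp only: poly_op_mult[OF lin, symmetric] power2_eq_square ac_simps)
    finally show ?thesis by (simp add: P_def)
  qed
  then have "(\<Sum>i\<le>N. inner (bern_op N i (node_dev N i x)) (node_dev N i x))
      = inner (poly_op A (\<Sum>i\<le>N. bern N i * [:- (real i / real N), 1:] ^ 2) x) x"
    by (simp only: poly_op_sum[OF lin] inner_sum_left)
  also have "\<dots> = inner (A (x - A x)) x / real N"
    by (simp only: bern_variance[OF assms] poly_op_smult[OF lin] poly_op_id) simp
  also have "inner (A (x - A x)) x \<le> (norm x)\<^sup>2"
  proof -
    have "inner (A (x - A x)) x \<le> norm (A (x - A x)) * norm x" by (rule norm_cauchy_schwarz)
    also have "\<dots> \<le> norm x * norm x"
      using order_trans[OF contr contr'] by (intro mult_right_mono) auto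
    finally show ?thesis by (simp add: power2_eq_square)
  qed
  finally show ?thesis using assms by (simp add: divide_right_mono)
qed

text \<open>Cauchy--Schwarz for each of the positive forms \<open>\<langle>bern_op N i x, y\<rangle>\<close> and then for the sum over
  the nodes reduces this to the variance bound.\<close>

lemma norm_weighted_dev_le:
  assumes "N > 0" and c: "\<And>i. i \<le> N \<Longrightarrow> 0 \<le> c i \<and> c i \<le> 1"
  shows "norm (\<Sum>i\<le>N. c i *\<^sub>R bern_op N i (node_dev N i x)) \<le> norm x / sqrt (real N)"
proof -
  define z where "z = (\<Sum>i\<le>N. c i *\<^sub>R bern_op N i (node_dev N i x))"
  define d where "d i = inner (bern_op N i (node_dev N i x)) (node_dev N i x)" for i
  define e where "e i = inner (bern_op N i z) z" for i
  have d0: "0 \<le> d i" and e0: "0 \<le> e i" for i by (simp_all add: d_def e_def bern_op_pos)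
  have "(norm z)\<^sup>2 = (\<Sum>i\<le>N. c i * inner (bern_op N i (node_dev N i x)) z)"
    by (subst (2) z_def) (simp add: power2_norm_eq_inner z_def inner_sum_left)
  also have "\<dots> \<le> (\<Sum>i\<le>N. sqrt (d i) * sqrt (e i))"
  proof (rule sum_mono)
    fix i assume "i \<in> {..N}"
    then have ci: "0 \<le> c i" "c i \<le> 1" using c by auto
    have "c i * inner (bern_op N i (node_dev N i x)) z \<le> c i * \<bar>inner (bern_op N i (node_dev N i x)) z\<bar>"
      using ci by (intro mult_left_mono) auto
    also have "\<dots> \<le> \<bar>inner (bern_op N i (node_dev N i x)) z\<bar>"
      using ci by (simp add: mult_left_le_one_le)
    also have "\<dots> \<le> sqrt (d i * e i)"
      using form_Cauchy_Schwarz[OF poly_op_form bern_op_pos, of N i "node_dev N i x" z]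
      by (intro real_le_rsqrt) (simp add: d_def e_def)
    finally show "c i * inner (bern_op N i (node_dev N i x)) z \<le> sqrt (d i) * sqrt (e i)"
      by (simp add: real_sqrt_mult)
  qed
  also have "\<dots> \<le> sqrt ((\<Sum>i\<le>N. d i) * (\<Sum>i\<le>N. e i))"
    using Cauchy_Schwarz_ineq_sum[of "\<lambda>i. sqrt (d i)" "\<lambda>i. sqrt (e i)" "{..N}"]
    by (intro real_le_rsqrt) (simp add: d0 e0)
  also have "\<dots> \<le> sqrt ((norm x)\<^sup>2 / real N * (norm z)\<^sup>2)"
    using bern_op_variance[OF assms(1), of x] sum_bern_op_inner[of N z z]
    by (intro real_sqrt_le_mono mult_mono) (auto simp: d_def e_def bern_op_pos sum_nonneg power2_norm_eq_inner)
  also have "\<dots> = norm x / sqrt (real N) * norm z"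
    by (simp add: real_sqrt_mult real_sqrt_divide)
  finally have "norm z * norm z \<le> norm x / sqrt (real N) * norm z"
    by (simp add: power2_eq_square)
  then have "norm z \<le> norm x / sqrt (real N)"
    by (cases "z = 0") (auto simp del: times_divide_eq_left)
  then show ?thesis by (simp add: z_def)
qed

text \<open>The Bernstein approximations of \<open>t\<^sup>p\<close>, evaluated at \<open>A\<close>, converge in norm. In the induction
  step one factor \<open>i / N\<close> is replaced by \<open>A\<close>, at the cost of a weighted sum of deviations.\<close>

lemma bernstein_power_error:
  assumes "N > 0"
  shows "norm ((\<Sum>i\<le>N. (real i / real N) ^ p *\<^sub>R bern_op N i x) - (A ^^ p) x)
    \<le> real p * (norm x / sqrt (real N))"
proof (induction p arbitrary: x)
  case 0
  then show ?case by (simp add: sum_bern_op)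
next
  case (Suc p)
  let ?r = "\<lambda>i. real i / real N"
  let ?S = "\<Sum>i\<le>N. ?r i ^ p *\<^sub>R bern_op N i (node_dev N i x)"
  have "(\<Sum>i\<le>N. ?r i ^ Suc p *\<^sub>R bern_op N i x) = (\<Sum>i\<le>N. ?r i ^ p *\<^sub>R bern_op N i (A x)) - ?S"
    by (simp add: sum_subtractf[symmetric] bern_op_diff bern_op_scale scaleR_diff_right power_commutes
        mult.commute)
  then have "(\<Sum>i\<le>N. ?r i ^ Suc p *\<^sub>R bern_op N i x) - (A ^^ Suc p) x
      = ((\<Sum>i\<le>N. ?r i ^ p *\<^sub>R bern_op N i (A x)) - (A ^^ p) (A x)) - ?S"
    by (simp add: funpow_swap1)
  then have "norm ((\<Sum>i\<le>N. ?r i ^ Suc p *\<^sub>R bern_op N i x) - (A ^^ Suc p) x)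
      \<le> norm ((\<Sum>i\<le>N. ?r i ^ p *\<^sub>R bern_op N i (A x)) - (A ^^ p) (A x)) + norm ?S"
    using norm_triangle_ineq4 by simp
  also have "\<dots> \<le> real p * (norm (A x) / sqrt (real N)) + norm x / sqrt (real N)"
    using assms by (intro add_mono Suc norm_weighted_dev_le) (auto simp: power_le_one)
  also have "\<dots> \<le> real p * (norm x / sqrt (real N)) + norm x / sqrt (real N)"
    by (intro add_right_mono mult_left_mono divide_right_mono contr) auto
  finally show ?case by (simp add: distrib_right add.commute del: times_divide_eq_right)
qed

lemma bernstein_power_tendsto:
  "(\<lambda>N. \<Sum>i\<le>Suc N. (real i / real (Suc N)) ^ p *\<^sub>R bern_op (Suc N) i x) \<longlonglongrightarrow> (A ^^ p) x"
proof -
  have "(\<lambda>N. real p * (norm x / sqrt (real (Suc N)))) \<longlonglongrightarrow> 0"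
  proof -
    have "(\<lambda>N. inverse (real (Suc N))) \<longlonglongrightarrow> 0" by (rule LIMSEQ_inverse_real_of_nat)
    then have "(\<lambda>N. sqrt (inverse (real (Suc N)))) \<longlonglongrightarrow> sqrt 0" by (rule tendsto_real_sqrt)
    then have "(\<lambda>N. real p * norm x * sqrt (inverse (real (Suc N)))) \<longlonglongrightarrow> real p * norm x * sqrt 0"
      by (intro tendsto_mult tendsto_const)
    then show ?thesis by (simp add: real_sqrt_inverse divide_inverse mult.assoc)
  qed
  then have "(\<lambda>N. (\<Sum>i\<le>Suc N. (real i / real (Suc N)) ^ p *\<^sub>R bern_op (Suc N) i x) - (A ^^ p) x)
      \<longlonglongrightarrow> 0"
    by (rule Lim_null_comparison[rotated])
       (intro always_eventually allI bernstein_power_error zero_less_Suc)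
  then show ?thesis by (rule LIM_zero_cancel)
qed

text \<open>A family of inequalities that is polynomial in the scalar \<open>l\<close>, with coefficients for which \<open>A\<close>
  is symmetric, survives the substitution of \<open>A\<close> for \<open>l\<close>: the inequality at the node \<open>i / N\<close>
  is weighted with the \<open>i\<close>-th Bernstein operator, and the results are added.\<close>

lemma operator_substitution:
  assumes F: "A_form F" and G: "A_form G" and H: "A_form H"
    and pos: "\<And>l x. 0 \<le> l \<Longrightarrow> l \<le> 1 \<Longrightarrow> 0 \<le> F x x + l ^ p * G x x + l ^ q * H x x"
  shows "0 \<le> F x x + G ((A ^^ p) x) x + H ((A ^^ q) x) x"
proof -
  interpret F: bounded_bilinear F by (rule A_form_bilinear[OF F])
  interpret G: bounded_bilinear G by (rule A_form_bilinear[OF G])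
  interpret H: bounded_bilinear H by (rule A_form_bilinear[OF H])
  let ?B = "\<lambda>r N. \<Sum>i\<le>Suc N. (real i / real (Suc N)) ^ r *\<^sub>R bern_op (Suc N) i x"
  have "(\<lambda>N. F x x + G (?B p N) x + H (?B q N) x)
      \<longlonglongrightarrow> F x x + G ((A ^^ p) x) x + H ((A ^^ q) x) x"
    by (intro tendsto_add tendsto_const G.tendsto H.tendsto bernstein_power_tendsto)
  moreover have "0 \<le> F x x + G (?B p N) x + H (?B q N) x" for N
  proof -
    let ?r = "\<lambda>i. real i / real (Suc N)"
    have "0 \<le> (\<Sum>i\<le>Suc N. (F (bern_op (Suc N) i x) x + ?r i ^ p * G (bern_op (Suc N) i x) x)
        + ?r i ^ q * H (bern_op (Suc N) i x) x)"
    proof (rule sum_nonneg)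
      fix i assume "i \<in> {..Suc N}"
      then have r: "0 \<le> ?r i" "?r i \<le> 1" by auto
      have *: "A_form (\<lambda>x y. (F x y + ?r i ^ p * G x y) + ?r i ^ q * H x y)"
        by (intro A_form_combine F G H)
      show "0 \<le> (F (bern_op (Suc N) i x) x + ?r i ^ p * G (bern_op (Suc N) i x) x)
        + ?r i ^ q * H (bern_op (Suc N) i x) x"
        by (rule bern_pos[OF *]) (rule pos[OF r])
    qed
    also have "\<dots> = F (\<Sum>i\<le>Suc N. bern_op (Suc N) i x) x + G (?B p N) x + H (?B q N) x"
      by (simp only: sum.distrib F.sum_left G.sum_left H.sum_left G.scaleR_left H.scaleR_left
          real_scaleR_def)
    finally show ?thesis by (simp only: sum_bern_op)
  qed
  ultimately show ?thesis by (intro LIMSEQ_le_const) auto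
qed

section \<open>Approximate spectral slices\<close>

text \<open>A partial sum \<open>G\<close> of the partition of unity satisfies \<open>0 \<le> G \<le> 1\<close>, hence \<open>G\<^sup>2 \<le> G\<close> and
  \<open>\<parallel>G y\<parallel> \<le> \<parallel>y\<parallel>\<close>.\<close>

lemma bern_block_square_le:
  assumes "I \<subseteq> {..N}"
  shows "(norm (\<Sum>i\<in>I. bern_op N i y))\<^sup>2 \<le> (\<Sum>i\<in>I. inner (bern_op N i y) y)"
    and "norm (\<Sum>i\<in>I. bern_op N i y) \<le> norm y"
proof -
  define G where "G = poly_op A (\<Sum>i\<in>I. bern N i)"
  have G: "G x = (\<Sum>i\<in>I. bern_op N i x)" for x by (simp add: G_def poly_op_sum[OF lin])
  have pos: "0 \<le> inner (G x) x" for x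
    by (simp add: G inner_sum_left sum_nonneg bern_op_pos)
  have le: "inner (G x) x \<le> (norm x)\<^sup>2" for x
  proof -
    have "inner (G x) x \<le> (\<Sum>i\<le>N. inner (bern_op N i x) x)"
      unfolding G inner_sum_left using assms by (intro sum_mono2) (auto simp: bern_op_pos)
    then show ?thesis by (simp add: sum_bern_op_inner power2_norm_eq_inner)
  qed
  define z where "z = G y"
  have "(inner (G y) z)\<^sup>2 \<le> inner (G y) y * inner (G z) z"
    using form_Cauchy_Schwarz[OF poly_op_form, of "\<Sum>i\<in>I. bern N i" y z] pos
    by (simp add: G_def)
  also have "\<dots> \<le> inner (G y) y * (norm z)\<^sup>2" by (intro mult_left_mono le pos)
  also have "inner (G y) z = (norm z)\<^sup>2" by (simp add: z_def power2_norm_eq_inner)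
  finally have cs: "(norm z)\<^sup>2 * (norm z)\<^sup>2 \<le> inner (G y) y * (norm z)\<^sup>2"
    by (simp only: power2_eq_square[of "(norm z)\<^sup>2"])
  have *: "(norm z)\<^sup>2 \<le> inner (G y) y"
  proof (cases "z = 0")
    case True
    then show ?thesis using pos[of y] by simp
  next
    case False
    then have "0 < (norm z)\<^sup>2" by simp
    with cs show ?thesis by (rule mult_right_le_imp_le)
  qed
  then show "(norm (\<Sum>i\<in>I. bern_op N i y))\<^sup>2 \<le> (\<Sum>i\<in>I. inner (bern_op N i y) y)"
    by (simp add: z_def G inner_sum_left)
  show "norm (\<Sum>i\<in>I. bern_op N i y) \<le> norm y"
    using order_trans[OF * le] by (simp add: z_def G)
qed

text \<open>If the nodes of a block lie within \<open>w\<close> of \<open>l\<close>, then the block maps \<open>x\<close> to an approximate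
  eigenvector for \<open>l\<close>. The right-hand side is a sum over the nodes, so that the bounds for
  disjoint blocks can be added.\<close>

lemma bern_block_spectral:
  fixes x :: 'a
  assumes I: "I \<subseteq> {..N}" and w: "\<And>i. i \<in> I \<Longrightarrow> \<bar>real i / real N - l\<bar> \<le> w"
  defines "g \<equiv> \<Sum>i\<in>I. bern_op N i x"
  shows "(norm (A g - l *\<^sub>R g))\<^sup>2
    \<le> (\<Sum>i\<in>I. 2 * inner (bern_op N i (node_dev N i x)) (node_dev N i x) + 2 * w\<^sup>2 * inner (bern_op N i x) x)"
proof -
  define y where "y = A x - l *\<^sub>R x"
  have "A g - l *\<^sub>R g = (\<Sum>i\<in>I. bern_op N i y)"
    by (simp add: g_def y_def linear_sum[OF lin] poly_op_apply[OF lin] bern_op_diff bern_op_scale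
        scaleR_sum_right sum_subtractf)
  then have "(norm (A g - l *\<^sub>R g))\<^sup>2 \<le> (\<Sum>i\<in>I. inner (bern_op N i y) y)"
    using bern_block_square_le(1)[OF I] by simp
  also have "\<dots> \<le> (\<Sum>i\<in>I. 2 * inner (bern_op N i (node_dev N i x)) (node_dev N i x) + 2 * w\<^sup>2 * inner (bern_op N i x) x)"
  proof (rule sum_mono)
    fix i assume i: "i \<in> I"
    define t where "t = real i / real N - l"
    define u where "u = node_dev N i x"
    define q where "q x y = inner (bern_op N i x) y" for x y
    have y: "y = u + t *\<^sub>R x" by (simp add: y_def u_def t_def scaleR_diff_left)
    have q: "sym_form q" using poly_op_form by (simp add: q_def[abs_def])
    have "0 \<le> q (u + (- t) *\<^sub>R x) (u + (- t) *\<^sub>R x)" by (simp add: q_def bern_op_pos del: scaleR_minus_left)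
    then have "q y y \<le> 2 * q u u + 2 * t\<^sup>2 * q x x"
      unfolding y sym_form_square[OF q] by (simp add: algebra_simps)
    also have "t\<^sup>2 \<le> w\<^sup>2" using w[OF i] by (simp add: t_def abs_le_square_iff[symmetric])
    then have "2 * q u u + 2 * t\<^sup>2 * q x x \<le> 2 * q u u + 2 * w\<^sup>2 * q x x"
      by (intro add_left_mono mult_right_mono mult_left_mono) (auto simp: q_def bern_op_pos)
    finally show "inner (bern_op N i y) y
      \<le> 2 * inner (bern_op N i (node_dev N i x)) (node_dev N i x) + 2 * w\<^sup>2 * inner (bern_op N i x) x"
      by (simp add: q_def u_def)
  qed
  finally show ?thesis .
qed

lemma sum_bern_block_bound:
  assumes "N > 0" "I \<subseteq> {..N}"
  shows "(\<Sum>i\<in>I. 2 * inner (bern_op N i (node_dev N i x)) (node_dev N i x) + 2 * w\<^sup>2 * inner (bern_op N i x) x)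
    \<le> (2 / real N + 2 * w\<^sup>2) * (norm x)\<^sup>2"
proof -
  have "(\<Sum>i\<in>I. 2 * inner (bern_op N i (node_dev N i x)) (node_dev N i x) + 2 * w\<^sup>2 * inner (bern_op N i x) x)
    \<le> (\<Sum>i\<le>N. 2 * inner (bern_op N i (node_dev N i x)) (node_dev N i x) + 2 * w\<^sup>2 * inner (bern_op N i x) x)"
    using assms(2) by (intro sum_mono2) (auto simp: bern_op_pos)
  also have "\<dots> = 2 * (\<Sum>i\<le>N. inner (bern_op N i (node_dev N i x)) (node_dev N i x)) + 2 * w\<^sup>2 * (norm x)\<^sup>2"
    by (simp only: sum.distrib sum_distrib_left[symmetric] sum_bern_op_inner power2_norm_eq_inner)
  also have "\<dots> \<le> 2 * ((norm x)\<^sup>2 / real N) + 2 * w\<^sup>2 * (norm x)\<^sup>2"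
    by (intro add_right_mono mult_left_mono bern_op_variance assms(1)) simp
  finally show ?thesis by (simp add: algebra_simps)
qed

lemma inverse_sqrt_tendsto_0: "(\<lambda>n. c * sqrt (inverse (real (Suc n)))) \<longlonglongrightarrow> 0"
proof -
  have "(\<lambda>n. c * sqrt (inverse (real (Suc n)))) \<longlonglongrightarrow> c * sqrt 0"
    by (intro tendsto_mult tendsto_const tendsto_real_sqrt LIMSEQ_inverse_real_of_nat)
  then show ?thesis by simp
qed

text \<open>A linear map that is dominated by \<open>A - l\<close> for every \<open>l\<close> in \<open>(0,1]\<close> is zero. The constant may blow
  up as \<open>l\<close> tends to \<open>0\<close>, provided that the map is small on vectors on which \<open>A\<close> is small.
  The nodes \<open>i / N\<close> with \<open>N = M\<^sup>2\<close> are grouped into blocks of \<open>M\<close> consecutive ones, so that the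
  width of a block and the standard deviation of the Bernstein operators are both of order
  \<open>1 / M\<close>. The blocks below \<open>1 / p\<close> are taken together; the other ones contribute \<open>O (1 / \<surd>M)\<close>.
  Then \<open>M\<close> tends to infinity, and \<open>p\<close> after it.\<close>

lemma vanishing_by_slicing:
  fixes C :: "'a \<Rightarrow> 'a"
  assumes C: "linear C" and K0: "K0 \<ge> 0" "\<And>x. (norm (C x))\<^sup>2 \<le> K0 * norm (A x) * norm x"
    and slice: "\<And>e. e > 0 \<Longrightarrow> \<exists>K\<ge>0. \<forall>l x. e \<le> l \<longrightarrow> l \<le> 1 \<longrightarrow>
      norm (C x) \<le> K * norm (A x - l *\<^sub>R x)"
  shows "C x = 0"
proof -
  have low_bound: "norm (C x) \<le> sqrt (2 * K0) * norm x * sqrt (inverse (real (Suc k)))" for k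
  proof -
    define p where "p = Suc k"
    obtain K where K: "K \<ge> 0"
      "\<And>l x. 1 / real p \<le> l \<Longrightarrow> l \<le> 1 \<Longrightarrow> norm (C x) \<le> K * norm (A x - l *\<^sub>R x)"
      using slice[of "1 / real p"] by (auto simp: p_def)
    have step: "norm (C x) \<le> sqrt (2 * K0) * norm x * sqrt (inverse (real p))
        + 2 * K * norm x * sqrt (inverse (real (Suc L')))" for L'
    proof -
      define L where "L = Suc L'"
      define M where "M = L * p"
      define N where "N = M * M"
      have pos: "p > 0" "L > 0" "M > 0" "N > 0" by (simp_all add: p_def L_def M_def N_def)
      define I where "I = {i \<in> {..N}. i div M < L}"
      define J where "J = {i \<in> {..N}. \<not> i div M < L}"
      define B where "B l = {i \<in> J. i div M = l}" for l
      define g where "g = (\<Sum>i\<in>I. bern_op N i x)"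
      define h where "h l = (\<Sum>i\<in>B l. bern_op N i x)" for l
      have IJ: "I \<inter> J = {}" "I \<union> J = {..N}" "finite I" "finite J" by (auto simp: I_def J_def)
      have "(\<lambda>i. i div M) ` J \<subseteq> {L..M}"
      proof
        fix l assume "l \<in> (\<lambda>i. i div M) ` J"
        then obtain i where i: "i \<le> M * M" "L \<le> i div M" "l = i div M" by (auto simp: J_def N_def)
        then have "i div M \<le> M" using div_le_mono[OF i(1), of M] pos by simp
        then show "l \<in> {L..M}" using i by simp
      qed
      then have hsum: "(\<Sum>l=L..M. \<Sum>i\<in>B l. f i) = (\<Sum>i\<in>J. f i)" for f :: "nat \<Rightarrow> 'b::comm_monoid_add"
        unfolding B_def by (intro sum.group IJ) auto
      have x: "x = g + (\<Sum>l=L..M. h l)"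
        using sum.union_disjoint[OF IJ(3,4,1), of "\<lambda>i. bern_op N i x"]
        by (simp add: g_def h_def hsum IJ(2) sum_bern_op)
      have low: "norm (C g) \<le> sqrt (2 * K0) * norm x * sqrt (inverse (real p))"
      proof -
        have "\<bar>real i / real N - 0\<bar> \<le> 1 / real p" if "i \<in> I" for i
        proof -
          have "i < L * M" using that pos by (simp add: I_def div_less_iff_less_mult)
          then have "real i \<le> real L * real M" by (metis less_imp_le of_nat_le_iff of_nat_mult)
          then have "real i / real N \<le> real L * real M / real N"
            by (intro divide_right_mono) auto
          also have "\<dots> = 1 / real p" using pos by (simp add: N_def M_def)
          finally show ?thesis by simp
        qed
        then have "(norm (A g - 0 *\<^sub>R g))\<^sup>2
            \<le> (\<Sum>i\<in>I. 2 * inner (bern_op N i (node_dev N i x)) (node_dev N i x) + 2 * (1 / real p)\<^sup>2 * inner (bern_op N i x) x)"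
          unfolding g_def by (intro bern_block_spectral) (auto simp: I_def)
        also have "\<dots> \<le> (2 / real N + 2 * (1 / real p)\<^sup>2) * (norm x)\<^sup>2"
          using pos by (intro sum_bern_block_bound) (auto simp: I_def)
        also have "\<dots> \<le> (2 / real p)\<^sup>2 * (norm x)\<^sup>2"
        proof (intro mult_right_mono)
          have "p \<le> M" using pos by (simp add: M_def)
          then have "p * p \<le> N" unfolding N_def by (intro mult_le_mono)
          then have "real p * real p \<le> real N" by (metis of_nat_le_iff of_nat_mult)
          then have "2 / real N \<le> 2 / (real p * real p)" using pos by (intro divide_left_mono) auto
          then show "2 / real N + 2 * (1 / real p)\<^sup>2 \<le> (2 / real p)\<^sup>2"
            by (simp add: power2_eq_square)
        qed simp
        finally have Ag: "norm (A g) \<le> 2 / real p * norm x"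
          by (simp add: power_mult_distrib[symmetric] abs_le_square_iff[symmetric] abs_mult)
        have "(norm (C g))\<^sup>2 \<le> K0 * norm (A g) * norm g" by (rule K0)
        also have "\<dots> \<le> K0 * (2 / real p * norm x) * norm x"
          using K0(1) Ag bern_block_square_le(2)[of I N x]
          by (intro mult_mono mult_left_mono) (auto simp: g_def I_def)
        also have "\<dots> = (sqrt (2 * K0) * norm x * sqrt (inverse (real p)))\<^sup>2"
          using K0(1) by (simp add: power_mult_distrib power2_eq_square[of "norm x"] divide_inverse)
        finally show ?thesis
          by (rule power2_le_imp_le) (use K0(1) in auto)
      qed
      have high: "norm (C (\<Sum>l=L..M. h l)) \<le> 2 * K * norm x * sqrt (inverse (real L))"
      proof -
        define d where "d l = norm (A (h l) - (real l / real M) *\<^sub>R h l)" for l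
        have sub: "B l \<subseteq> {..N}" for l by (auto simp: B_def J_def)
        have "\<bar>real i / real N - real l / real M\<bar> \<le> 1 / real M" if "i \<in> B l" for i l
        proof -
          have "i = l * M + i mod M" using that by (auto simp: B_def)
          then have "real i = real l * real M + real (i mod M)" by (metis of_nat_add of_nat_mult)
          then have "real i / real N - real l / real M = real (i mod M) / real M * (1 / real M)"
            using pos by (simp add: N_def field_simps)
          moreover have "real (i mod M) / real M \<le> 1"
            using pos by (simp add: less_imp_le)
          ultimately show ?thesis
            using divide_right_mono[of "real (i mod M) / real M" 1 "real M"] by simp
        qed
        then have "(d l)\<^sup>2 \<le> (\<Sum>i\<in>B l. 2 * inner (bern_op N i (node_dev N i x)) (node_dev N i x)
            + 2 * (1 / real M)\<^sup>2 * inner (bern_op N i x) x)" for l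
          unfolding h_def d_def by (intro bern_block_spectral sub)
        then have "(\<Sum>l=L..M. (d l)\<^sup>2) \<le> (\<Sum>l=L..M. \<Sum>i\<in>B l. 2 * inner (bern_op N i (node_dev N i x)) (node_dev N i x)
            + 2 * (1 / real M)\<^sup>2 * inner (bern_op N i x) x)"
          by (intro sum_mono)
        also have "\<dots> = (\<Sum>i\<in>J. 2 * inner (bern_op N i (node_dev N i x)) (node_dev N i x)
            + 2 * (1 / real M)\<^sup>2 * inner (bern_op N i x) x)" by (rule hsum)
        also have "\<dots> \<le> (2 / real N + 2 * (1 / real M)\<^sup>2) * (norm x)\<^sup>2"
          using pos by (intro sum_bern_block_bound) (auto simp: J_def)
        also have "\<dots> = (2 / real M * norm x)\<^sup>2" by (simp add: N_def power2_eq_square)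
        finally have d2: "(\<Sum>l=L..M. (d l)\<^sup>2) \<le> (2 / real M * norm x)\<^sup>2" .
        have "(\<Sum>l=L..M. d l)\<^sup>2 \<le> (\<Sum>l=L..M. (d l)\<^sup>2) * real (card {L..M})"
          by (rule sum_squared_le_sum_of_squares)
        also have "\<dots> \<le> (2 / real M * norm x)\<^sup>2 * real M"
          using d2 pos by (intro mult_mono) auto
        also have "\<dots> = (2 * norm x * sqrt (inverse (real M)))\<^sup>2"
          using pos by (simp add: power_mult_distrib power_divide power2_eq_square field_simps)
        finally have d1: "(\<Sum>l=L..M. d l) \<le> 2 * norm x * sqrt (inverse (real M))"
          by (rule power2_le_imp_le) auto
        have "norm (C (\<Sum>l=L..M. h l)) \<le> (\<Sum>l=L..M. norm (C (h l)))"
          unfolding linear_sum[OF C] by (rule norm_sum)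
        also have "\<dots> \<le> (\<Sum>l=L..M. K * d l)"
        proof (rule sum_mono)
          fix l assume l: "l \<in> {L..M}"
          have "1 / real p = real L / real M" using pos by (simp add: M_def)
          also have "\<dots> \<le> real l / real M" using l by (intro divide_right_mono) auto
          finally show "norm (C (h l)) \<le> K * d l"
            unfolding d_def using l pos by (intro K(2)) auto
        qed
        also have "\<dots> \<le> K * (2 * norm x * sqrt (inverse (real M)))"
          unfolding sum_distrib_left[symmetric] by (intro mult_left_mono d1 K(1))
        also have "\<dots> \<le> K * (2 * norm x * sqrt (inverse (real L)))"
          using K(1) pos by (intro mult_left_mono real_sqrt_le_mono le_imp_inverse_le) (auto simp: M_def)
        finally show ?thesis by (simp add: mult_ac)
      qed
      have "norm (C x) \<le> norm (C g) + norm (C (\<Sum>l=L..M. h l))"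
        by (subst x) (simp add: linear_add[OF C] norm_triangle_ineq)
      then show ?thesis using low high by (simp add: L_def)
    qed
    have "(\<lambda>L'. sqrt (2 * K0) * norm x * sqrt (inverse (real p))
        + 2 * K * norm x * sqrt (inverse (real (Suc L'))))
        \<longlonglongrightarrow> sqrt (2 * K0) * norm x * sqrt (inverse (real p)) + 0"
      by (intro tendsto_add tendsto_const inverse_sqrt_tendsto_0)
    then have "norm (C x) \<le> sqrt (2 * K0) * norm x * sqrt (inverse (real p)) + 0"
      by (rule LIMSEQ_le_const) (use step in auto)
    then show ?thesis by (simp add: p_def)
  qed
  have "norm (C x) \<le> 0"
    by (rule LIMSEQ_le_const[OF inverse_sqrt_tendsto_0]) (use low_bound in auto)
  then show ?thesis by simp
qed

section \<open>Moments\<close>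

text \<open>The moments of the spectral measure of \<open>A\<close> at \<open>x\<close>.\<close>

definition moment :: "'a \<Rightarrow> nat \<Rightarrow> real" where
  "moment x k = inner ((A ^^ k) x) x"

text \<open>Odd powers of \<open>A\<close> are covered because composing a positive form with \<open>A\<close> keeps it positive.\<close>

lemma moment_nonneg: "0 \<le> moment x k"
proof -
  have "A_form F \<Longrightarrow> (\<And>x. 0 \<le> F x x) \<Longrightarrow> 0 \<le> F ((A ^^ k) x) x" for F
  proof (induction k arbitrary: F)
    case 0
    then show ?case by simp
  next
    case (Suc k)
    show ?case
      using Suc.IH[OF A_form_apply[OF Suc.prems(1)]] A_form_apply_pos(1)[OF Suc.prems] by simp
  qed
  from this[OF A_form_inner] show ?thesis by (simp add: moment_def)
qed

lemma moment_le: "moment x k \<le> (norm x)\<^sup>2"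
proof -
  have "norm ((A ^^ k) x) \<le> norm x" by (induction k) (auto intro: order_trans[OF contr])
  then have "norm ((A ^^ k) x) * norm x \<le> norm x * norm x" by (intro mult_right_mono) auto
  then show ?thesis
    unfolding moment_def power2_eq_square using norm_cauchy_schwarz order_trans by blast
qed

text \<open>The second difference with weight \<open>l\<close> multiplies the spectral measure by \<open>(t - l)\<^sup>2\<close>, which
  is the measure at \<open>(A - l) x\<close>.\<close>

lemma second_diff_moment: "second_diff l (moment x) k = moment (A x - l *\<^sub>R x) k"
proof -
  have shift: "inner ((A ^^ k) u) (A v) = inner ((A ^^ k) (A u)) v" for u v
    by (simp add: sym[symmetric] funpow_swap1)
  show ?thesis
    by (simp add: moment_def second_diff_def linear_diff[OF linear_funpow[OF lin]]
        linear_scale[OF linear_funpow[OF lin]] inner_diff_left inner_diff_right shift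
        linear_diff[OF lin] linear_scale[OF lin] power2_eq_square algebra_simps)
       (simp add: funpow_swap1)
qed

text \<open>By \<open>tangent_remainder\<close>, the moment form of the tangent deviation is a sum of nonnegative terms;
  its last term alone gives the lower bound.\<close>

lemma moment_tangent_lower:
  assumes "0 \<le> l" "m \<ge> 1"
  shows "real m * l ^ (m - 1) * (norm (A x - l *\<^sub>R x))\<^sup>2
    \<le> moment x (Suc m) - real (Suc m) * l ^ m * moment x 1 + real m * l ^ Suc m * moment x 0"
proof -
  obtain k where k: "m = Suc k" using assms(2) by (cases m) auto
  have "0 \<le> (\<Sum>j<k. real (Suc j) * l ^ j * second_diff l (moment x) (m - 1 - j))"
    using assms(1) by (intro sum_nonneg mult_nonneg_nonneg) (auto simp: second_diff_moment moment_nonneg)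
  moreover have "second_diff l (moment x) 0 = (norm (A x - l *\<^sub>R x))\<^sup>2"
    by (simp add: second_diff_moment moment_def power2_norm_eq_inner)
  ultimately show ?thesis unfolding tangent_remainder by (simp add: k)
qed

lemma moment_tangent_upper:
  assumes "0 \<le> l" "l \<le> 1"
  shows "moment x (Suc m) - real (Suc m) * l ^ m * moment x 1 + real m * l ^ Suc m * moment x 0
    \<le> (real m * norm (A x - l *\<^sub>R x))\<^sup>2"
proof -
  let ?u = "A x - l *\<^sub>R x"
  have "real (Suc j) * l ^ j * second_diff l (moment x) (m - 1 - j) \<le> real m * (norm ?u)\<^sup>2"
    if "j < m" for j
  proof -
    have "real (Suc j) * l ^ j * moment ?u (m - 1 - j) \<le> (real m * 1) * (norm ?u)\<^sup>2"
      using that assms by (intro mult_mono moment_le) (auto simp: power_le_one moment_nonneg)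
    then show ?thesis by (simp add: second_diff_moment)
  qed
  then have "(\<Sum>j<m. real (Suc j) * l ^ j * second_diff l (moment x) (m - 1 - j))
      \<le> (\<Sum>j<m. real m * (norm ?u)\<^sup>2)"
    by (intro sum_mono) auto
  then show ?thesis unfolding tangent_remainder by (simp add: power2_eq_square mult_ac)
qed

end

section \<open>Paranormal operators\<close>

lemma paranormal_second_diff:
  fixes T :: "'a::real_normed_vector \<Rightarrow> 'a"
  assumes para: "\<And>x. (norm (T x))\<^sup>2 \<le> norm (T (T x)) * norm x" and l: "l \<ge> 0"
  shows "0 \<le> second_diff l (\<lambda>k. (norm ((T ^^ k) x))\<^sup>2) k"
proof -
  define y where "y = (T ^^ k) x"
  have "0 \<le> (norm (T (T y)) - l * norm y)\<^sup>2" by simp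
  also have "\<dots> = (norm (T (T y)))\<^sup>2 - 2 * l * (norm (T (T y)) * norm y) + l\<^sup>2 * (norm y)\<^sup>2"
    by (simp add: power2_eq_square algebra_simps)
  also have "\<dots> \<le> (norm (T (T y)))\<^sup>2 - 2 * l * (norm (T y))\<^sup>2 + l\<^sup>2 * (norm y)\<^sup>2"
    using para[of y] l by (simp add: mult_left_mono)
  finally show ?thesis by (simp add: second_diff_def y_def)
qed

text \<open>In the next lemmas \<open>A\<close> is the operator \<open>T\<^sup>* T\<close>, described by its form so that no adjoint and no
  completeness is needed.\<close>

lemma gram_operator_linear:
  fixes T A :: "'a::real_inner \<Rightarrow> 'a"
  assumes T: "linear T" and gram: "\<And>x y. inner (T x) (T y) = inner (A x) y"
  shows "linear A"
proof (rule linearI)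
  have eqI: "u = v" if "\<And>z. inner u z = inner v z" for u v :: 'a
  proof -
    have "inner (u - v) (u - v) = 0" using that[of "u - v"] by (simp add: inner_diff_left)
    then show ?thesis by simp
  qed
  show "A (x + y) = A x + A y" for x y
    by (rule eqI) (simp add: gram[symmetric] linear_add[OF T] inner_add_left)
  show "A (c *\<^sub>R x) = c *\<^sub>R A x" for c x
    by (rule eqI) (simp add: gram[symmetric] linear_scale[OF T])
qed

lemma gram_positive_contraction:
  fixes T A :: "'a::real_inner \<Rightarrow> 'a"
  assumes T: "linear T" and contr: "\<And>x. norm (T x) \<le> norm x"
    and gram: "\<And>x y. inner (T x) (T y) = inner (A x) y"
  shows "positive_contraction A" and "(norm (A x))\<^sup>2 \<le> inner (A x) x"
proof -
  have le: "norm (A x) \<le> norm (T x)" for x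
  proof -
    have "norm (A x) * norm (A x) = inner (T x) (T (A x))"
      by (simp add: gram power2_norm_eq_inner[symmetric] power2_eq_square)
    also have "\<dots> \<le> norm (T x) * norm (T (A x))" by (rule norm_cauchy_schwarz)
    also have "\<dots> \<le> norm (T x) * norm (A x)" by (intro mult_left_mono contr) simp
    finally show ?thesis by (cases "A x = 0") auto
  qed
  have sq: "(norm (A x))\<^sup>2 \<le> inner (A x) x" for x
    using power_mono[OF le[of x], of 2] gram[of x x] by (simp add: power2_norm_eq_inner)
  then show "(norm (A x))\<^sup>2 \<le> inner (A x) x" .
  show "positive_contraction A"
  proof (rule positive_contraction.intro)
    show "linear A" by (rule gram_operator_linear[OF T gram])
    show "inner (A x) y = inner x (A y)" for x y
      using gram[of x y] gram[of y x] by (simp add: inner_commute)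
    show "norm (A x) \<le> norm x" for x using order_trans[OF le contr] .
    show "norm (x - A x) \<le> norm x" for x
    proof (rule power2_le_imp_le)
      have "0 \<le> inner (A x) x" using gram[of x x] by (metis inner_ge_zero)
      then show "(norm (x - A x))\<^sup>2 \<le> (norm x)\<^sup>2"
        using sq[of x] by (simp add: power2_norm_eq_inner inner_diff_left inner_diff_right inner_commute)
    qed simp
  qed
qed

text \<open>The heart of the argument, for the exponent \<open>n = m + 1 \<ge> 2\<close>.\<close>

lemma paranormal_contraction_commutes:
  fixes T A :: "'a::real_inner \<Rightarrow> 'a"
  assumes T: "bounded_linear T" and T_contr: "\<And>x. norm (T x) \<le> norm x"
    and gram: "\<And>x y. inner (T x) (T y) = inner (A x) y"
    and comm: "\<And>x. (T ^^ Suc m) (A x) = A ((T ^^ Suc m) x)" and m: "m \<ge> 1"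
    and para: "\<And>x. (norm (T x))\<^sup>2 \<le> norm (T (T x)) * norm x"
  shows "T (A x) = A (T x)"
proof -
  note linT = bounded_linear.linear[OF T]
  interpret positive_contraction A by (rule gram_positive_contraction(1)[OF linT T_contr gram])
  define b where "b x k = (norm ((T ^^ k) x))\<^sup>2" for x k
  define B where "B x y = inner ((T ^^ Suc m) x) ((T ^^ Suc m) y)" for x y
  have b0: "b x 0 = inner x x" and b1: "b x (Suc 0) = inner (A x) x" for x
    by (simp_all add: b_def power2_norm_eq_inner gram)
  have bB: "b x (Suc m) = B x x" for x by (simp add: b_def B_def power2_norm_eq_inner)
  have bBA: "b x (Suc (Suc m)) = B (A x) x" for x
  proof -
    have "b x (Suc (Suc m)) = inner (A ((T ^^ Suc m) x)) ((T ^^ Suc m) x)"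
      using gram[of "(T ^^ Suc m) x" "(T ^^ Suc m) x"] by (simp add: b_def power2_norm_eq_inner)
    then show ?thesis by (simp only: comm[symmetric] B_def)
  qed
  have sd: "0 \<le> second_diff l (b x) k" if "l \<ge> 0" for l x k
    using paranormal_second_diff[OF para that] by (simp add: b_def[abs_def])
  have Tk: "bounded_linear (T ^^ k)" for k
  proof (induction k)
    case 0
    then show ?case by (simp add: id_def bounded_linear_ident)
  next
    case (Suc k)
    show ?case using bounded_linear_compose[OF T Suc] by (simp add: o_def)
  qed
  have "bounded_bilinear B"
    unfolding B_def[abs_def] by (rule bounded_bilinear.comp[OF bounded_bilinear_inner Tk Tk])
  moreover have "B x y = B y x" for x y by (simp add: B_def inner_commute)
  moreover have "B (A x) y = B x (A y)" for x y unfolding B_def comm sym ..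
  ultimately have B: "A_form B" by (simp add: A_form_def sym_form_def)
  \<comment> \<open>substitute \<open>A\<close> for \<open>l\<close> in the forward tangent inequality\<close>
  have lower: "moment x (Suc m) \<le> b x (Suc m)" for x
  proof -
    have "0 \<le> B x x + (- real (Suc m)) * inner (A ((A ^^ m) x)) x
        + real m * inner ((A ^^ Suc m) x) x"
    proof (rule operator_substitution[OF B, where p = m and q = "Suc m"
          and G = "\<lambda>x y. - real (Suc m) * inner (A x) y" and H = "\<lambda>x y. real m * inner x y"])
      fix l :: real and x assume "0 \<le> l" "l \<le> 1"
      then show "0 \<le> B x x + l ^ m * (- real (Suc m) * inner (A x) x) + l ^ Suc m * (real m * inner x x)"
        using tangent_nonneg[of l "b x" m] sd by (simp add: b0 b1 bB algebra_simps)
    qed (intro A_form_scale A_form_inner A_form_apply)+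
    then show ?thesis by (simp add: bB moment_def algebra_simps)
  qed
  \<comment> \<open>substitute \<open>A\<close> for \<open>l\<close> in the backward tangent inequality and cancel the multiples of \<open>B (A x) x\<close>\<close>
  have upper: "b x (Suc (Suc m)) \<le> moment x (Suc (Suc m))" for x
  proof -
    have "0 \<le> real (Suc m) * B (A x) x + (- real (Suc (Suc m))) * B ((A ^^ 1) x) x
        + inner ((A ^^ Suc (Suc m)) x) x"
    proof (rule operator_substitution[where p = 1 and q = "Suc (Suc m)"
          and F = "\<lambda>x y. real (Suc m) * B (A x) y"
          and G = "\<lambda>x y. - real (Suc (Suc m)) * B x y" and H = inner])
      fix l :: real and x assume "0 \<le> l" "l \<le> 1"
      then show "0 \<le> real (Suc m) * B (A x) x + l ^ 1 * (- real (Suc (Suc m)) * B x x)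
          + l ^ Suc (Suc m) * inner x x"
        using backward_tangent_nonneg[of l "b x" "Suc m"] sd by (simp add: b0 bB bBA algebra_simps)
    qed (intro A_form_scale A_form_inner A_form_apply B)+
    then show ?thesis by (simp add: bBA moment_def algebra_simps)
  qed
  \<comment> \<open>the lower bound at \<open>T x\<close>, one step of convexity at \<open>x\<close>, and the upper bound at \<open>x\<close>\<close>
  have key: "real m * l ^ (m - 1) * (norm (A (T x) - l *\<^sub>R T x))\<^sup>2
      \<le> (real (Suc m) * norm (A x - l *\<^sub>R x))\<^sup>2" if l: "0 \<le> l" "l \<le> 1" for l x
  proof -
    have bT: "b (T x) k = b x (Suc k)" for k by (simp add: b_def funpow_swap1)
    have m0: "moment y 0 = b y 0" and m1: "moment y 1 = b y 1" for y
      by (simp_all add: moment_def b0 b1)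
    have "real m * l ^ (m - 1) * (norm (A (T x) - l *\<^sub>R T x))\<^sup>2
        \<le> b (T x) (Suc m) - real (Suc m) * l ^ m * b (T x) 1 + real m * l ^ Suc m * b (T x) 0"
      using moment_tangent_lower[OF l(1) m, of "T x"] lower[of "T x"] by (simp only: m0 m1)
    also have "\<dots> = b x (Suc (Suc m)) - real (Suc m) * l ^ m * b x 2 + real m * l ^ Suc m * b x 1"
      by (simp add: bT numeral_2_eq_2)
    also have "\<dots> \<le> b x (Suc (Suc m)) - real (Suc (Suc m)) * l ^ Suc m * b x 1
        + real (Suc m) * l ^ Suc (Suc m) * b x 0"
    proof -
      have "0 \<le> real (Suc m) * l ^ m * second_diff l (b x) 0"
        using l sd by simp
      then show ?thesis by (simp add: second_diff_def algebra_simps power2_eq_square numeral_2_eq_2)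
    qed
    also have "\<dots> \<le> moment x (Suc (Suc m)) - real (Suc (Suc m)) * l ^ Suc m * moment x 1
        + real (Suc m) * l ^ Suc (Suc m) * moment x 0"
      using upper[of x] by (simp only: m0 m1)
    also have "\<dots> \<le> (real (Suc m) * norm (A x - l *\<^sub>R x))\<^sup>2"
      by (rule moment_tangent_upper[OF l])
    finally show ?thesis .
  qed
  define C where "C x = T (A x) - A (T x)" for x
  have "C x = 0"
  proof (rule vanishing_by_slicing[where C = C and ?K0.0 = 4])
    show "linear C"
      unfolding C_def[abs_def]
      using linear_compose_sub[OF linear_compose[OF lin linT] linear_compose[OF linT lin]]
      by (simp add: o_def)
    show "(norm (C x))\<^sup>2 \<le> 4 * norm (A x) * norm x" for x
    proof -
      have "norm (C x) \<le> norm (T (A x)) + norm (A (T x))"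
        unfolding C_def by (rule norm_triangle_ineq4)
      also have "\<dots> \<le> norm (A x) + norm (T x)"
        using T_contr[of "A x"] contr[of "T x"] by simp
      finally have "(norm (C x))\<^sup>2 \<le> (norm (A x) + norm (T x))\<^sup>2" by (intro power_mono) auto
      also have "\<dots> \<le> 2 * (norm (A x))\<^sup>2 + 2 * (norm (T x))\<^sup>2"
        using sum_squares_ge_zero[of "norm (A x) - norm (T x)" 0]
        by (simp add: power2_eq_square algebra_simps)
      also have "\<dots> \<le> 4 * inner (A x) x"
        using gram_positive_contraction(2)[OF linT T_contr gram, of x]
        by (simp add: power2_norm_eq_inner[of "T x"] gram)
      also have "\<dots> \<le> 4 * (norm (A x) * norm x)" by (intro mult_left_mono norm_cauchy_schwarz) simp
      finally show ?thesis by simp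
    qed
    fix e :: real assume e: "e > 0"
    define K where "K = 1 + real (Suc m) / sqrt (e ^ (m - 1))"
    have "norm (C x) \<le> K * norm (A x - l *\<^sub>R x)" if l: "e \<le> l" "l \<le> 1" for l x
    proof -
      define u where "u = A x - l *\<^sub>R x"
      define v where "v = A (T x) - l *\<^sub>R T x"
      have "(sqrt (e ^ (m - 1)) * norm v)\<^sup>2 = 1 * e ^ (m - 1) * (norm v)\<^sup>2"
        using e by (simp add: power_mult_distrib)
      also have "\<dots> \<le> real m * l ^ (m - 1) * (norm v)\<^sup>2"
        using e l m by (intro mult_right_mono mult_mono power_mono) auto
      also have "\<dots> \<le> (real (Suc m) * norm u)\<^sup>2"
        unfolding u_def v_def using e l by (intro key) auto
      finally have "sqrt (e ^ (m - 1)) * norm v \<le> real (Suc m) * norm u"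
        by (rule power2_le_imp_le) simp
      then have "norm v \<le> real (Suc m) / sqrt (e ^ (m - 1)) * norm u"
        using e by (simp add: field_simps)
      moreover have "C x = T u - v"
        by (simp add: C_def u_def v_def linear_diff[OF linT] linear_scale[OF linT])
      then have "norm (C x) \<le> norm u + norm v"
        using norm_triangle_ineq4[of "T u" v] T_contr[of u] by simp
      ultimately show ?thesis by (simp add: K_def u_def distrib_right)
    qed
    moreover have "K \<ge> 0" using e by (simp add: K_def)
    ultimately show "\<exists>K\<ge>0. \<forall>l x. e \<le> l \<longrightarrow> l \<le> 1 \<longrightarrow> norm (C x) \<le> K * norm (A x - l *\<^sub>R x)"
      by blast
  qed simp
  then show ?thesis by (simp add: C_def)
qed

text \<open>Reduction to contractions: with \<open>T\<close> replaced by \<open>c T\<close>, the operator \<open>T\<^sup>* T\<close> is multiplied by \<open>c\<^sup>2\<close>,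
  and paranormality and the commutation hypothesis persist. For \<open>n = 1\<close> there is nothing to prove.\<close>

lemma paranormal_commutes:
  fixes T A :: "'a::real_inner \<Rightarrow> 'a"
  assumes T: "bounded_linear T"
    and gram: "\<And>x y. inner (T x) (T y) = inner (A x) y"
    and comm: "\<And>x. (T ^^ n) (A x) = A ((T ^^ n) x)" and n: "n \<ge> 1"
    and para: "\<And>x. (norm (T x))\<^sup>2 \<le> norm (T (T x)) * norm x"
  shows "T (A x) = A (T x)"
proof (cases "n = 1")
  case True
  then show ?thesis using comm by simp
next
  case False
  then obtain m where m: "n = Suc m" "m \<ge> 1" using n by (cases n) auto
  note linT = bounded_linear.linear[OF T]
  note linA = gram_operator_linear[OF linT gram]
  obtain K where K: "K > 0" "\<And>x. norm (T x) \<le> norm x * K"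
    using bounded_linear.pos_bounded[OF T] by blast
  define c where "c = inverse K"
  have c: "c > 0" using K by (simp add: c_def)
  define S where "S x = c *\<^sub>R T x" for x
  define D where "D x = c\<^sup>2 *\<^sub>R A x" for x
  have pow: "(S ^^ k) x = c ^ k *\<^sub>R (T ^^ k) x" for k x
    by (induction k) (simp_all add: S_def linear_scale[OF linT])
  have "S (D x) = D (S x)"
  proof (rule paranormal_contraction_commutes)
    show "bounded_linear S"
      unfolding S_def[abs_def] by (rule bounded_linear_compose[OF bounded_linear_scaleR_right T])
    show "norm (S x) \<le> norm x" for x
      using K(2)[of x] K(1) by (simp add: S_def c_def field_simps)
    show "inner (S x) (S y) = inner (D x) y" for x y
      by (simp add: S_def D_def gram power2_eq_square)
    show "(S ^^ Suc m) (D x) = D ((S ^^ Suc m) x)" for x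
      using comm[of x] unfolding pow m(1)
      by (simp add: D_def linear_scale[OF linA] linear_scale[OF linear_funpow[OF linT]] linear_scale[OF linT])
    show "m \<ge> 1" by (rule m(2))
    show "(norm (S x))\<^sup>2 \<le> norm (S (S x)) * norm x" for x
    proof -
      have "c\<^sup>2 * (norm (T x))\<^sup>2 \<le> c\<^sup>2 * (norm (T (T x)) * norm x)"
        by (intro mult_left_mono para) simp
      then show ?thesis
        using c by (simp add: S_def linear_scale[OF linT] power_mult_distrib power2_eq_square mult.assoc)
    qed
  qed
  then have "(c * c\<^sup>2) *\<^sub>R T (A x) = (c * c\<^sup>2) *\<^sub>R A (T x)"
    by (simp add: S_def D_def linear_scale[OF linT] linear_scale[OF linA] mult.commute)
  then show ?thesis using c by simp
qed

section \<open>Adjoints\<close>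

text \<open>The representing vector minimizes \<open>\<parallel>x\<parallel>\<^sup>2 - 2 f x\<close>; the parallelogram law makes minimizing
  sequences Cauchy.\<close>

lemma Riesz_representation:
  fixes f :: "'a::{real_inner, complete_space} \<Rightarrow> real"
  assumes f: "bounded_linear f"
  shows "\<exists>z. \<forall>x. f x = inner x z"
proof -
  interpret f: bounded_linear f by (rule f)
  define J where "J x = (norm x)\<^sup>2 - 2 * f x" for x
  define m where "m = Inf (range J)"
  obtain K where K: "\<And>x. norm (f x) \<le> norm x * K" using f.bounded by blast
  have "- (K\<^sup>2) \<le> J x" for x
  proof -
    have "f x \<le> norm x * K" using K[of x] by simp
    moreover have "0 \<le> (norm x - K)\<^sup>2" by simp
    ultimately show ?thesis by (simp add: J_def power2_eq_square algebra_simps)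
  qed
  then have bdd: "bdd_below (range J)" by (auto simp: bdd_below_def)
  have mJ: "m \<le> J x" for x unfolding m_def by (intro cInf_lower bdd) auto
  have "\<exists>x. J x < m + inverse (real (Suc n))" for n
  proof -
    have "\<exists>y\<in>range J. y < m + inverse (real (Suc n))"
      using bdd by (subst cInf_less_iff[symmetric]) (auto simp: m_def)
    then show ?thesis by auto
  qed
  then obtain u where u: "\<And>n. J (u n) < m + inverse (real (Suc n))" by metis
  have parallelogram: "(norm (x - y))\<^sup>2 = 2 * J x + 2 * J y - 4 * J ((1/2) *\<^sub>R (x + y))" for x y
    by (simp add: J_def f.add f.scaleR power2_norm_eq_inner inner_diff_left inner_diff_right
        inner_add_left inner_add_right inner_commute algebra_simps)
  have "Cauchy u"
  proof (rule metric_CauchyI)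
    fix e :: real assume e: "e > 0"
    then have "e\<^sup>2 / 4 > 0" by simp
    then obtain N where N: "inverse (real (Suc N)) < e\<^sup>2 / 4" using reals_Archimedean by blast
    have "dist (u i) (u j) < e" if "i \<ge> N" "j \<ge> N" for i j
    proof -
      have close: "J (u k) < m + e\<^sup>2 / 4" if "k \<ge> N" for k
      proof -
        have "inverse (real (Suc k)) \<le> inverse (real (Suc N))" using that by simp
        then show ?thesis using u[of k] N by linarith
      qed
      have "(norm (u i - u j))\<^sup>2 < e\<^sup>2"
        using mJ[of "(1/2) *\<^sub>R (u i + u j)"] close[OF that(1)] close[OF that(2)]
        unfolding parallelogram by linarith
      then show ?thesis using e by (simp add: dist_norm power2_less_imp_less)
    qed
    then show "\<exists>M. \<forall>i\<ge>M. \<forall>j\<ge>M. dist (u i) (u j) < e" by blast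
  qed
  then obtain z where z: "u \<longlonglongrightarrow> z" using Cauchy_convergent convergent_def by blast
  have "(\<lambda>n. J (u n)) \<longlonglongrightarrow> J z"
    unfolding J_def by (intro tendsto_intros f.tendsto z)
  moreover have "(\<lambda>n. m + inverse (real (Suc n))) \<longlonglongrightarrow> m + 0"
    by (intro tendsto_intros LIMSEQ_inverse_real_of_nat)
  ultimately have "J z \<le> m + 0" by (rule LIMSEQ_le) (use u less_imp_le in blast)
  then have Jmin: "J z \<le> J x" for x using mJ[of x] by simp
  have "f w = inner w z" for w
  proof (cases "w = 0")
    case True
    then show ?thesis by (simp add: f.zero)
  next
    case False
    define d where "d = inner w z - f w"
    have w: "(norm w)\<^sup>2 > 0" using False by simp
    \<comment> \<open>the minimizer of \<open>J\<close> on the line through \<open>z\<close> in direction \<open>w\<close>\<close>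
    define t where "t = - d / (norm w)\<^sup>2"
    have "J (z + t *\<^sub>R w) = J z + (2 * t * d + t\<^sup>2 * (norm w)\<^sup>2)"
      by (simp add: J_def d_def f.add f.scaleR power2_norm_eq_inner inner_add_left inner_add_right
          inner_commute power2_eq_square[of t] algebra_simps)
    also have "2 * t * d + t\<^sup>2 * (norm w)\<^sup>2 = - (d\<^sup>2 / (norm w)\<^sup>2)"
      using w by (simp add: t_def field_simps power2_eq_square)
    finally have "d\<^sup>2 / (norm w)\<^sup>2 \<le> 0" using Jmin[of "z + t *\<^sub>R w"] by simp
    then have "d\<^sup>2 \<le> 0" using w by (simp add: divide_le_0_iff)
    then show ?thesis by (simp add: d_def)
  qed
  then show ?thesis by blast
qed

text \<open>An adjoint for the real inner product is also one for the complex inner product, because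
  \<open>Im \<langle>u, v\<rangle> = Re \<langle>- \<i> u, v\<rangle>\<close>.\<close>

lemma cadjoint_works:
  fixes T :: "'a::chilbert_space \<Rightarrow> 'a"
  assumes T: "bounded_clinear T"
  shows "cinner (T x) y = cinner x (cadjoint T y)"
proof -
  interpret T: bounded_clinear T by (rule T)
  have "\<exists>s. \<forall>x. inner (T x) y = inner x s" for y
    by (rule Riesz_representation)
       (rule bounded_linear_compose[OF bounded_linear_inner_left T.bounded_linear_axioms])
  then obtain S where S: "\<And>x y. inner (T x) y = inner x (S y)" by metis
  have Re: "Re (cinner (T x) y) = Re (cinner x (S y))" for x y
    using S[of x y] by (simp add: inner_eq_Re_cinner)
  have "cinner (T x) y = cinner x (S y)" for x y
  proof (rule complex_eqI)
    show "Re (cinner (T x) y) = Re (cinner x (S y))" by (rule Re)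
    show "Im (cinner (T x) y) = Im (cinner x (S y))"
      using Re[of "(- \<i>) *\<^sub>C x" y] by (simp add: T.scaleC cinner_scaleC_left)
  qed
  then have "\<exists>S. \<forall>x y. cinner (T x) y = cinner x (S y)" by blast
  from someI_ex[OF this] show ?thesis unfolding cadjoint_def by blast
qed

section \<open>Paranormal power quasinormal operators\<close>

theorem theorem4p6:
  fixes n :: nat and T :: "'a::chilbert_space \<Rightarrow> 'a"
  assumes "n \<ge> 1"
    and "bounded_clinear T"
    and "power_quasinormal n T"
    and "paranormal T"
  shows "quasinormal T"
proof -
  interpret T: bounded_clinear T by (rule assms(2))
  define A where "A = cadjoint T \<circ> T"
  have gram: "inner (T x) (T y) = inner (A x) y" for x y
    using cadjoint_works[OF assms(2), of y "T x"]
    by (metis A_def comp_apply inner_commute inner_eq_Re_cinner)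
  have comm: "(T ^^ n) (A x) = A ((T ^^ n) x)" for x
    using fun_cong[OF assms(3)[unfolded power_quasinormal_def], of x]
    by (simp add: commutator_def A_def)
  have para: "(norm (T x))\<^sup>2 \<le> norm (T (T x)) * norm x" for x
    using assms(4) by (simp add: paranormal_def numeral_2_eq_2)
  have "T (A x) = A (T x)" for x
    by (rule paranormal_commutes[OF T.bounded_linear_axioms gram comm assms(1) para])
  then show ?thesis by (simp add: quasinormal_def commutator_def A_def)
qed

end
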